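(* Let $Q \in \mathcal{P}(\mathbb{R}^p)$ satisfy $Q(\{x\})=0$ for all $x\in\mathbb{R}^p$ and admit a positive, continuous and bounded density on $\mathcal{X}=\mathbb{R}^p$. Let $P\in\mathcal{P}_2(\mathbb{R}^d)$ have a strictly positive density on $\mathbb{R}^d$. Let $l := \lceil \log_2(p+1)\rceil$ and $\mathcal{T}_n := \mathcal{R}_{l,n}(\mathbb{R}^p\rightarrow\mathbb{R}^d)$ for $n\in\mathbb{N}$. Then there exists a subset $\mathfrak{T}\subseteq\prod_{i=1}^d L^2(Q)$ containing an element $T\in\mathfrak{T}$ for which $T_\#Q=P$, and the sequence $(\mathcal{T}_n)_{n\in\mathbb{N}}$ satisfies $\mathcal{T}_n\subseteq\mathfrak{T}$ for all $n$, $\mathcal{T}_n\subseteq\mathcal{T}_m$ for $n\leq m$, and $\mathcal{T}_\infty := \lim_{n\to\infty}\mathcal{T}_n = \bigcup_{n\in\mathbb{N}}\mathcal{T}_n$ is a dense set in $\mathfrak{T}$.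
   Context: $\mathcal{P}(\mathbb{R}^p)$ is the set of Borel probability measures on $\mathbb{R}^p$; $\mathcal{P}_2(\mathbb{R}^d)$ is the set of those on $\mathbb{R}^d$ with $\int\|x\|^2\,\mathrm{d}P(x)<\infty$. Densities are with respect to Lebesgue measure. $T_\#Q$ is the pushforward of $Q$ through $T$. $L^2(Q)$ is the Hilbert space of real-valued functions square-integrable with respect to $Q$; $\prod_{i=1}^d L^2(Q)$ (viewed as maps $\mathbb{R}^p\to\mathbb{R}^d$) has squared norm $\sum_{i=1}^d\|T_i\|^2_{L^2(Q)}$, and density is with respect to this norm. Deep ReLU neural networks: let $\sigma(x)=\max(0,x)$, applied componentwise. A deep ReLU neural network with $l$ hidden layers from $\mathbb{R}^p$ to $\mathbb{R}^d$ is a function $f = F_{l+1}\circ\sigma\circ F_l\circ\dots\circ F_2\circ\sigma\circ F_1$, where $F_i:\mathbb{R}^{w_{i-1}}\rightarrow\mathbb{R}^{w_i}$, $i=1,\dots,l$, is affine, $F_{l+1}:\mathbb{R}^{w_l}\rightarrow\mathbb{R}^{w_{l+1}}$ is linear, $w_0=p$, $w_{l+1}=d$, and $w_i\in\mathbb{N}$, $i=1,\dots,l$, is the width of the $i$th hidden layer. $\mathcal{R}_{l,n}(\mathbb{R}^p\rightarrow\mathbb{R}^d)$ is the set of all such functions with $l$ hidden layers and $\max\{w_1,\dots,w_l\}\leq n$.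
   Formalization: Networks are restricted to those in the product of L²(Q) in the inclusion in 𝔗 and in density: if Q has no finite second moment (e.g. Cauchy, p=1), max(0,x) is not in L²(Q), so the claim fails; with a finite second moment it is the literal claim. *)

theory Defs
  imports "HOL-Probability.Probability"
begin

definition finite_second_moment :: "('a::euclidean_space) measure set" where
  "finite_second_moment =
     {P \<in> space (prob_algebra borel). integrable P (\<lambda>x. (norm x)\<^sup>2)}"

text \<open>
  The product of the spaces \<open>L\<^sup>2(Q)\<close>, through representatives: functions that agree
  \<open>Q\<close>-almost everywhere are not identified, so \<open>L2_norm\<close> is a seminorm.
\<close>

definition L2_maps :: "(real ^ 'p) measure \<Rightarrow> (real ^ 'p \<Rightarrow> real ^ 'd) set" where
  "L2_maps Q = {T \<in> borel_measurable Q. \<forall>i. integrable Q (\<lambda>x. (T x $ i)\<^sup>2)}"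

definition L2_norm :: "(real ^ 'p) measure \<Rightarrow> (real ^ 'p \<Rightarrow> real ^ 'd) \<Rightarrow> real" where
  "L2_norm Q T = sqrt (\<Sum>i\<in>UNIV. \<integral>x. (T x $ i)\<^sup>2 \<partial>Q)"

definition L2_dense_in ::
    "(real ^ 'p) measure \<Rightarrow> (real ^ 'p \<Rightarrow> real ^ 'd) set \<Rightarrow> (real ^ 'p \<Rightarrow> real ^ 'd) set \<Rightarrow> bool" where
  "L2_dense_in Q S A \<longleftrightarrow>
     S \<subseteq> A \<and> (\<forall>T\<in>A. \<forall>\<epsilon>>0. \<exists>g\<in>S. L2_norm Q (\<lambda>x. T x - g x) < \<epsilon>)"

text \<open>
  The output of a hidden layer of width \<open>w\<close> is a point of \<open>\<real>\<^sup>w\<close>, encoded as a function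
  \<open>nat \<Rightarrow> real\<close> of which only the coordinates \<open>j < w\<close> matter: every later layer reads only
  those. \<open>relu_hidden n i w g\<close> says that \<open>g = \<sigma> \<circ> F\<^sub>i \<circ> \<dots> \<circ> \<sigma> \<circ> F\<^sub>1\<close>
  with \<open>F\<^sub>1, \<dots>, F\<^sub>i\<close> affine, all layers of positive width at most \<open>n\<close> and the last one of width \<open>w\<close>.
\<close>

definition relu :: "real \<Rightarrow> real" where
  "relu x = max 0 x"

inductive relu_hidden ::
    "nat \<Rightarrow> nat \<Rightarrow> nat \<Rightarrow> (real ^ 'p \<Rightarrow> nat \<Rightarrow> real) \<Rightarrow> bool" for n where
  first: "1 \<le> w \<Longrightarrow> w \<le> n \<Longrightarrow>
    relu_hidden n 1 w (\<lambda>x j. relu ((\<Sum>k\<in>UNIV. A j k * x $ k) + b j))"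
| step: "relu_hidden n i w g \<Longrightarrow> 1 \<le> w' \<Longrightarrow> w' \<le> n \<Longrightarrow>
    relu_hidden n (Suc i) w' (\<lambda>x j. relu ((\<Sum>k<w. A j k * g x k) + b j))"

text \<open>For \<open>l \<ge> 1\<close>; the output map is linear, without a bias.\<close>

definition relu_nets :: "nat \<Rightarrow> nat \<Rightarrow> (real ^ 'p \<Rightarrow> real ^ 'd) set" where
  "relu_nets l n = {(\<lambda>x. \<chi> i. \<Sum>k<w. C i k * g x k) | w g C. relu_hidden n l w g}"

lemma relu_hidden_growth:
  fixes g :: "real ^ 'p \<Rightarrow> nat \<Rightarrow> real"
  assumes "relu_hidden n i w g"
  shows "(\<lambda>x. g x j) \<in> borel_measurable borel \<and> (\<exists>K\<ge>0. \<forall>x. \<bar>g x j\<bar> \<le> K * (1 + norm x))"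
  using assms
proof (induction arbitrary: j rule: relu_hidden.induct)
  case (first w A b)
  have "\<bar>relu ((\<Sum>k\<in>UNIV. A j k * x $ k) + b j)\<bar> \<le> ((\<Sum>k\<in>UNIV. \<bar>A j k\<bar>) + \<bar>b j\<bar>) * (1 + norm x)"
    for x :: "real ^ 'p"
  proof -
    have "\<bar>\<Sum>k\<in>UNIV. A j k * x $ k\<bar> \<le> (\<Sum>k\<in>UNIV. \<bar>A j k\<bar> * norm x)"
      by (intro order_trans[OF sum_abs] sum_mono)
         (simp add: abs_mult mult_left_mono component_le_norm_cart)
    then have 1: "\<bar>\<Sum>k\<in>UNIV. A j k * x $ k\<bar> \<le> (\<Sum>k\<in>UNIV. \<bar>A j k\<bar>) * norm x"
      by (simp add: sum_distrib_right)
    have 2: "0 \<le> (\<Sum>k\<in>UNIV. \<bar>A j k\<bar>)" by (simp add: sum_nonneg)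
    have 3: "0 \<le> \<bar>b j\<bar> * norm x" by simp
    have 4: "\<bar>relu y\<bar> \<le> \<bar>y\<bar>" for y by (simp add: relu_def)
    show ?thesis using 1 2 3 4[of "(\<Sum>k\<in>UNIV. A j k * x $ k) + b j"]
      by (simp only: distrib_right distrib_left mult_1_right)
  qed
  moreover have "0 \<le> (\<Sum>k\<in>UNIV. \<bar>A j k\<bar>) + \<bar>b j\<bar>" by (simp add: sum_nonneg)
  moreover have "(\<lambda>x. relu ((\<Sum>k\<in>UNIV. A j k * x $ k) + b j)) \<in> borel_measurable borel"
    unfolding relu_def by measurable
  ultimately show ?case by blast
next
  case (step i w g w' A b)
  have meas [measurable]: "\<And>k. (\<lambda>x. g x k) \<in> borel_measurable borel" using step.IH by blast
  obtain K where K: "\<And>k. K k \<ge> 0" "\<And>k x. \<bar>g x k\<bar> \<le> K k * (1 + norm x)"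
    using step.IH by metis
  have "\<bar>relu ((\<Sum>k<w. A j k * g x k) + b j)\<bar> \<le> ((\<Sum>k<w. \<bar>A j k\<bar> * K k) + \<bar>b j\<bar>) * (1 + norm x)"
    for x :: "real ^ 'p"
  proof -
    have "\<bar>\<Sum>k<w. A j k * g x k\<bar> \<le> (\<Sum>k<w. \<bar>A j k\<bar> * (K k * (1 + norm x)))"
      by (intro order_trans[OF sum_abs] sum_mono) (simp add: abs_mult mult_left_mono K)
    then have 1: "\<bar>\<Sum>k<w. A j k * g x k\<bar> \<le> (\<Sum>k<w. \<bar>A j k\<bar> * K k) * (1 + norm x)"
      by (simp add: sum_distrib_right mult.assoc)
    have 3: "\<bar>b j\<bar> \<le> \<bar>b j\<bar> * (1 + norm x)" by (simp add: algebra_simps)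
    have 4: "\<bar>relu y\<bar> \<le> \<bar>y\<bar>" for y by (simp add: relu_def)
    show ?thesis using 1 3 4[of "(\<Sum>k<w. A j k * g x k) + b j"] by (simp only: distrib_right)
  qed
  moreover have "0 \<le> (\<Sum>k<w. \<bar>A j k\<bar> * K k) + \<bar>b j\<bar>" by (simp add: sum_nonneg K)
  moreover have "(\<lambda>x. relu ((\<Sum>k<w. A j k * g x k) + b j)) \<in> borel_measurable borel"
    unfolding relu_def by measurable
  ultimately show ?case by blast
qed

lemma relu_hidden_coordinate:
  assumes "1 \<le> l" "1 \<le> n"
  shows "relu_hidden n l 1 (\<lambda>x j. relu (s * x $ i))"
  using assms(1)
proof (induction l rule: dec_induct)
  case base
  have "(\<Sum>k\<in>UNIV. (if k = i then s else 0) * x $ k) = s * x $ i" for x :: "real ^ 'a"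
    by (simp add: if_distrib[of "\<lambda>u. u * _"] cong: if_cong)
  then show ?case
    using relu_hidden.first[of 1 n "\<lambda>j k. if k = i then s else 0" "\<lambda>_. 0"] assms(2) by simp
next
  case (step l)
  show ?case
    using relu_hidden.step[OF step.IH, of 1 "\<lambda>j k. 1" "\<lambda>_. 0"] assms(2) by (simp add: relu_def)
qed

text \<open>
  Networks grow linearly, so all of them belong to \<open>L\<^sup>2(Q)\<close> exactly when \<open>Q\<close> has a finite
  second moment. For other \<open>Q\<close> (such as the Cauchy distribution) no subset of \<open>L\<^sup>2(Q)\<close>
  contains them all, and one has to read \<open>relu_nets l n\<close> within \<open>L\<^sup>2(Q)\<close>, that is, as
  \<open>relu_nets l n \<inter> L2_maps Q\<close>; by this lemma nothing changes if the second moment is finite.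
\<close>

lemma relu_nets_subset_L2_maps_iff:
  fixes Q :: "(real ^ 'p) measure"
  assumes Q: "Q \<in> space (prob_algebra borel)" and l: "1 \<le> l" and n: "1 \<le> n"
  shows "(relu_nets l n :: (real ^ 'p \<Rightarrow> real ^ 'd) set) \<subseteq> L2_maps Q \<longleftrightarrow> Q \<in> finite_second_moment"
proof
  have sets [measurable_cong]: "sets Q = sets borel" and "prob_space Q"
    using Q by (auto simp: space_prob_algebra)
  then interpret prob_space Q by simp
  {
    assume sub: "(relu_nets l n :: (real ^ 'p \<Rightarrow> real ^ 'd) set) \<subseteq> L2_maps Q"
    have int: "integrable Q (\<lambda>x. (relu (s * x $ i))\<^sup>2)" for s i
    proof -
      have "(\<lambda>x. \<chi> j. \<Sum>k<(1::nat). 1 * relu (s * x $ i)) \<in> (relu_nets l n :: (real ^ 'p \<Rightarrow> real ^ 'd) set)"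
        unfolding relu_nets_def mem_Collect_eq
        by (intro exI[of _ 1] exI[of _ "\<lambda>x j. relu (s * x $ i)"] exI[of _ "\<lambda>_ _. 1"] conjI refl
              relu_hidden_coordinate[OF l n])
      then have "(\<lambda>x. \<chi> j. \<Sum>k<(1::nat). 1 * relu (s * x $ i)) \<in> (L2_maps Q :: (real ^ 'p \<Rightarrow> real ^ 'd) set)" using sub by blast
      then show ?thesis by (simp add: L2_maps_def)
    qed
    have "(norm x)\<^sup>2 = (\<Sum>i\<in>UNIV. (relu (1 * x $ i))\<^sup>2 + (relu (- 1 * x $ i))\<^sup>2)" for x :: "real ^ 'p"
    proof -
      have "(relu (1 * y))\<^sup>2 + (relu (- 1 * y))\<^sup>2 = y\<^sup>2" for y
        by (simp add: relu_def max_def)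
      then show ?thesis
        by (simp only: norm_vec_def L2_set_def real_norm_def power2_abs) (simp add: sum_nonneg)
    qed
    then have "integrable Q (\<lambda>x. (norm x)\<^sup>2)"
      by (simp only:) (intro Bochner_Integration.integrable_sum Bochner_Integration.integrable_add int)
    then show "Q \<in> finite_second_moment" using Q by (simp add: finite_second_moment_def)
  }
  {
    assume "Q \<in> finite_second_moment"
    then have mom: "integrable Q (\<lambda>x. (norm x)\<^sup>2)" by (simp add: finite_second_moment_def)
    have sq: "(1 + norm x)\<^sup>2 \<le> 2 + 2 * (norm x)\<^sup>2" for x :: "real ^ 'p"
      using sum_squares_ge_zero[of "norm x - 1" 0] by (simp add: power2_eq_square algebra_simps)
    have dom: "integrable Q (\<lambda>x. 2 + 2 * (norm x)\<^sup>2)" using mom by simp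
    show "(relu_nets l n :: (real ^ 'p \<Rightarrow> real ^ 'd) set) \<subseteq> L2_maps Q"
    proof
      fix T :: "real ^ 'p \<Rightarrow> real ^ 'd" assume "T \<in> relu_nets l n"
      then obtain w g C where T: "T = (\<lambda>x. \<chi> i. \<Sum>k<w. C i k * g x k)" and g: "relu_hidden n l w g"
        unfolding relu_nets_def by blast
      have [measurable]: "\<And>k. (\<lambda>x. g x k) \<in> borel_measurable borel"
        using relu_hidden_growth[OF g] by blast
      obtain K where K: "\<And>k. K k \<ge> 0" "\<And>k x. \<bar>g x k\<bar> \<le> K k * (1 + norm x)"
        using relu_hidden_growth[OF g] by metis
      have comp [measurable]: "(\<lambda>x. T x $ i) \<in> borel_measurable borel" for i
        unfolding T by simp
      have "T \<in> borel_measurable borel"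
        by (subst borel_measurable_euclidean_space)
           (auto simp: Basis_vec_def inner_axis)
      moreover have "integrable Q (\<lambda>x. (T x $ i)\<^sup>2)" for i
      proof -
        define D where "D = (\<Sum>k<w. \<bar>C i k\<bar> * K k)"
        have "\<bar>T x $ i\<bar> \<le> D * (1 + norm x)" for x
        proof -
          have "\<bar>\<Sum>k<w. C i k * g x k\<bar> \<le> (\<Sum>k<w. \<bar>C i k\<bar> * (K k * (1 + norm x)))"
            by (intro order_trans[OF sum_abs] sum_mono) (simp add: abs_mult mult_left_mono K)
          then show ?thesis by (simp add: T D_def sum_distrib_right mult.assoc)
        qed
        then have "(T x $ i)\<^sup>2 \<le> D\<^sup>2 * (2 + 2 * (norm x)\<^sup>2)" for x
          using power_mono[of "\<bar>T x $ i\<bar>" "D * (1 + norm x)" 2] mult_left_mono[OF sq, of "D\<^sup>2" x]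
          by (simp add: power_mult_distrib)
        then have "norm ((T x $ i)\<^sup>2) \<le> norm (D\<^sup>2 * (2 + 2 * (norm x)\<^sup>2))" for x
          unfolding real_norm_def by (smt (verit) zero_le_power2)
        moreover have "integrable Q (\<lambda>x. D\<^sup>2 * (2 + 2 * (norm x)\<^sup>2))" using dom by simp
        moreover have "(\<lambda>x. (T x $ i)\<^sup>2) \<in> borel_measurable Q" by measurable
        ultimately show ?thesis
          by (rule Bochner_Integration.integrable_bound[rotated 2, OF AE_I2])
      qed
      ultimately show "T \<in> L2_maps Q" by (simp add: L2_maps_def measurable_cong_sets[OF sets refl])
    qed
  }
qed

end

theory Submission
  imports Defs
begin

text \<open>
  A single coordinate of \<open>x \<sim> Q\<close> has an atomless distribution \<open>\<mu>\<close> on the line, and this is enough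
  randomness to produce \<open>P\<close>: embed \<open>\<real>\<^sup>d\<close> into \<open>\<real>\<close> by a Borel map \<open>J\<close> with a Borel left inverse \<open>K\<close>,
  and apply to the coordinate the distribution function of \<open>\<mu>\<close>, the quantile function of \<open>J\<^sub>#P\<close>
  and \<open>K\<close>. The resulting transport map depends on one coordinate only, so it suffices to
  approximate in \<open>L\<^sup>2(\<mu>)\<close> on the line. There, bounded ramps are networks with one hidden layer, they
  converge to indicators of half-lines, and these generate all of \<open>L\<^sup>2(\<mu>)\<close>. Ramps being bounded,
  no moment assumption on \<open>Q\<close> is needed. For \<open>\<TT>\<close> one takes the closure of the networks in \<open>L\<^sup>2(Q)\<close>.
\<close>

section \<open>Transport from an atomless distribution on the line\<close>

definition ternary :: "(nat \<Rightarrow> bool) \<Rightarrow> real" where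
  "ternary b = (\<Sum>n. of_bool (b n) * (1 / 3) ^ n)"

text \<open>Greedy digit extraction, with the leading digit of weight 1. It is defined on all of
  \<real> so as to be Borel; only its values on the range of \<open>ternary\<close> matter.\<close>

fun ternary_digit :: "nat \<Rightarrow> real \<Rightarrow> bool" where
  "ternary_digit 0 t \<longleftrightarrow> 1 \<le> t"
| "ternary_digit (Suc n) t \<longleftrightarrow> ternary_digit n (3 * (t - of_bool (1 \<le> t)))"

lemma summable_ternary: "summable (\<lambda>n. of_bool (b n) * (1 / 3 :: real) ^ n)"
  by (rule summable_comparison_test'[of "\<lambda>n. (1 / 3 :: real) ^ n" 0]) (auto simp: summable_geometric)

lemma ternary_bounds: "0 \<le> ternary b" "ternary b \<le> 3 / 2"
proof -
  show "0 \<le> ternary b"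
    unfolding ternary_def by (intro suminf_nonneg summable_ternary) simp
  have "ternary b \<le> (\<Sum>n. (1 / 3 :: real) ^ n)"
    unfolding ternary_def by (intro suminf_le summable_ternary) (auto simp: summable_geometric)
  then show "ternary b \<le> 3 / 2"
    by (simp add: suminf_geometric)
qed

lemma ternary_step: "ternary b = of_bool (b 0) + ternary (\<lambda>n. b (Suc n)) / 3"
  using suminf_split_head[OF summable_ternary[of b]]
    suminf_mult[OF summable_ternary[of "\<lambda>n. b (Suc n)"], of "1 / 3"]
  by (simp add: ternary_def mult_ac)

text \<open>Only the digits 0 and 1 occur in base 3, so the tail after the leading digit adds at
  most 1/2 and comparison with 1 reveals that digit. Base 2 would leave ambiguous
  expansions.\<close>

lemma ternary_digit_ternary [simp]: "ternary_digit n (ternary b) = b n"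
proof (induction n arbitrary: b)
  case 0
  show ?case
    using ternary_step[of b] ternary_bounds[of "\<lambda>n. b (Suc n)"] by (cases "b 0") auto
next
  case (Suc n)
  have "1 \<le> ternary b \<longleftrightarrow> b 0"
    using ternary_step[of b] ternary_bounds[of "\<lambda>n. b (Suc n)"] by (cases "b 0") auto
  then have "3 * (ternary b - of_bool (1 \<le> ternary b)) = ternary (\<lambda>n. b (Suc n))"
    using ternary_step[of b] by simp
  then show ?case
    using Suc.IH by simp
qed

lemma measurable_ternary_digit [measurable]: "Measurable.pred borel (ternary_digit n)"
proof (induction n)
  case 0
  show ?case by simp
next
  case (Suc n)
  note Suc.IH [measurable]
  show ?case by simp
qed

text \<open>Recovers a real from the answers to all rational comparisons. The value \<infinity> is
  neutral for the infimum, and in \<open>ereal\<close> the infimum needs no boundedness.\<close>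

lemma INF_rat_above_eq:
  "(INF r::rat. if a < of_rat r then ereal (of_rat r) else \<infinity>) = ereal a"
proof (rule INF_eqI)
  show "ereal a \<le> (if a < of_rat r then ereal (of_rat r) else \<infinity>)" for r
    by auto
next
  fix y assume y: "\<And>r::rat. r \<in> UNIV \<Longrightarrow> y \<le> (if a < of_rat r then ereal (of_rat r) else \<infinity>)"
  show "y \<le> ereal a"
  proof (rule ccontr)
    assume "\<not> y \<le> ereal a"
    then obtain z where z: "ereal a < ereal z" "ereal z < y"
      by (meson ereal_dense2 not_le)
    then obtain r where "a < of_rat r" "of_rat r < z"
      using of_rat_dense[of a z] by auto
    then have "y \<le> ereal (of_rat r)" "ereal (of_rat r) < ereal z"
      using y[of r] by simp_all
    then have "y < ereal z" by (rule le_less_trans)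
    with z(2) show False by simp
  qed
qed

text \<open>A vector is encoded by the bits \<open>y $ i < r\<close> with \<open>r\<close> rational, which are then the ternary
  digits of a real number.\<close>

lemma ex_borel_embedding_real:
  "\<exists>(J :: real ^ 'd \<Rightarrow> real) K.
     J \<in> borel_measurable borel \<and> K \<in> borel_measurable borel \<and> (\<forall>y. K (J y) = y)"
proof -
  define J :: "real ^ 'd \<Rightarrow> real" where
    "J y = ternary (\<lambda>n. case from_nat n :: 'd \<times> rat of (i, r) \<Rightarrow> y $ i < of_rat r)" for y
  define K :: "real \<Rightarrow> real ^ 'd" where
    "K t = (\<chi> i. real_of_ereal
       (INF r::rat. if ternary_digit (to_nat (i, r)) t then ereal (of_rat r) else \<infinity>))" for t
  \<comment> \<open>An infimum over the countable type \<open>rat\<close> keeps each coordinate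
    Borel.\<close>
  have [measurable]: "(\<lambda>t. K t $ i) \<in> borel_measurable borel" for i
    unfolding K_def vec_lambda_beta by measurable
  have "K \<in> borel_measurable borel"
    by (subst borel_measurable_euclidean_space) (auto simp: Basis_vec_def inner_axis)
  moreover have "J \<in> borel_measurable borel"
    unfolding J_def ternary_def by (measurable; simp add: case_prod_beta)
  moreover have "K (J y) = y" for y
    unfolding vec_eq_iff K_def J_def vec_lambda_beta ternary_digit_ternary from_nat_to_nat prod.case
      INF_rat_above_eq by simp
  ultimately show ?thesis by blast
qed

section \<open>Distribution functions and quantiles\<close>

text \<open>The probability integral transform: without atoms the distribution function is
  continuous, and its value at a \<mu>-random point is uniform on [0,1].\<close>

lemma measure_cdf_le:
  assumes "real_distribution \<mu>" and atomless: "\<And>x. measure \<mu> {x} = 0" and c: "0 \<le> c" "c \<le> 1"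
  shows "measure \<mu> {x. cdf \<mu> x \<le> c} = c"
proof -
  interpret cdf_distribution \<mu>
    using assms(1) by (simp add: cdf_distribution_def)
  have S [measurable]: "{x. C x \<le> u} \<in> sets \<mu>" for u
    using measurable_sets[OF measurable_C, of "{..u}"] by (simp add: vimage_def)
  \<comment> \<open>Intermediate value theorem between the limits 0 and 1 at the two ends; the
    values 0 and 1 themselves may be missed.\<close>
  have attained: "\<exists>s. C s = u" if u: "0 < u" "u < 1" for u
  proof -
    have "eventually (\<lambda>x. u < C x) at_top" "eventually (\<lambda>x. C x < u) at_bot"
      using order_tendstoD(1)[OF cdf_lim_at_top_prob u(2)] order_tendstoD(2)[OF cdf_lim_at_bot u(1)] .
    then obtain a b where ab: "u < C b" "C a < u"
      by (auto simp: eventually_at_top_linorder eventually_at_bot_linorder)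
    then have "a \<le> b"
      using cdf_nondecreasing[of b a] by linarith
    moreover have "continuous_on {a..b} C"
      using isCont_cdf atomless by (simp add: continuous_at_imp_continuous_on)
    ultimately show ?thesis
      using IVT'[of C a u b] ab by auto
  qed
  \<comment> \<open>The sublevel set may reach beyond a point where \<open>C\<close> equals
    \<open>u\<close>, since \<open>C\<close> can be flat there. A strictly larger level
    \<open>v\<close> confines it to a half-line; \<open>v\<close> decreases to the level afterwards,
    which also covers level 0.\<close>
  have upper: "measure \<mu> {x. C x \<le> u} \<le> v" if v: "u < v" "0 < v" "v < 1" for u v
  proof -
    obtain s where "C s = v" using attained[of v] v by blast
    moreover have "{x. C x \<le> u} \<subseteq> {..s}"
      using v \<open>C s = v\<close> cdf_nondecreasing by (smt (verit) atMost_iff mem_Collect_eq subsetI)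
    ultimately show ?thesis
      using finite_measure_mono[of "{x. C x \<le> u}" "{..s}"] by (simp add: cdf_def)
  qed
  have lower: "c \<le> measure \<mu> {x. C x \<le> c}" if c: "0 < c" "c < 1"
  proof -
    obtain s where "C s = c" using attained[of c] c by blast
    then have "{..s} \<subseteq> {x. C x \<le> c}"
      using cdf_nondecreasing by auto
    then show ?thesis
      using finite_measure_mono[of "{..s}" "{x. C x \<le> c}"] \<open>C s = c\<close> S by (simp add: cdf_def)
  qed
  consider "c = 1" | "c < 1" using c by linarith
  then show ?thesis
  proof cases
    case 1
    then show ?thesis
      using cdf_bounded_prob prob_space by simp
  next
    case 2
    have "measure \<mu> {x. C x \<le> c} \<le> c"
      using 2 c by (intro dense_ge_bounded[of c 1]) (auto intro: upper)
    moreover have "c \<le> measure \<mu> {x. C x \<le> c}"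
      using lower 2 c by (cases "c = 0") auto
    ultimately show ?thesis by simp
  qed
qed

text \<open>Inverse transform sampling: the distribution function of \<mu> produces a uniform
  variable, and the quantile function \<open>I\<close> of \<nu> turns it into \<nu>.\<close>

lemma ex_transport_real:
  assumes "real_distribution \<mu>" and atomless: "\<And>x. measure \<mu> {x} = 0" and "real_distribution \<nu>"
  shows "\<exists>S \<in> borel_measurable borel. distr \<mu> borel S = \<nu>"
proof -
  interpret \<mu>: cdf_distribution \<mu>
    using assms(1) by (simp add: cdf_distribution_def)
  interpret \<nu>: cdf_distribution \<nu>
    using assms(3) by (simp add: cdf_distribution_def)
  note uniform = measure_cdf_le[OF assms(1) atomless]
  \<comment> \<open>The quantile function is controlled only on the open interval (0,1). The default
    0 is taken on a \<mu>-null set.\<close>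
  define S where "S x = (if 0 < \<mu>.C x \<and> \<mu>.C x < 1 then \<nu>.I (\<mu>.C x) else 0)" for x
  \<comment> \<open>The Galois connection between quantile and distribution function; it gives both
    measurability and the law of \<open>S\<close>.\<close>
  have le: "S x \<le> z \<longleftrightarrow> (if 0 < \<mu>.C x \<and> \<mu>.C x < 1 then \<mu>.C x \<le> \<nu>.C z else 0 \<le> z)" for x z
    using \<nu>.pseudoinverse[of "\<mu>.C x" z] by (auto simp: S_def)
  have S [measurable]: "S \<in> borel_measurable borel"
    unfolding borel_measurable_iff_le le by measurable
  have [measurable]: "\<mu>.C \<in> borel_measurable \<mu>"
    using \<mu>.measurable_C by (simp add: measurable_cong_sets[OF \<mu>.events_eq_borel refl])
  have [measurable]: "S \<in> borel_measurable \<mu>"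
    using S by (simp add: measurable_cong_sets[OF \<mu>.events_eq_borel refl])
  have "AE x in \<mu>. 0 < \<mu>.C x"
  proof -
    have "{x. \<mu>.C x \<le> 0} \<in> null_sets \<mu>"
      using uniform[of 0] by (intro null_setsI) (auto simp: \<mu>.emeasure_eq_measure)
    then show ?thesis
      by (rule AE_I') auto
  qed
  moreover have "AE x in \<mu>. \<mu>.C x < 1"
  proof -
    have "\<mu>.prob {x. \<mu>.C x \<ge> 1} \<le> 0 + e" if "0 < e" for e
    proof -
      \<comment> \<open>The \<open>max\<close> keeps the level in [0,1], where
        \<open>uniform\<close> applies, even for \<open>e\<close> above 1.\<close>
      have "\<mu>.prob {x. \<mu>.C x \<ge> 1} \<le> \<mu>.prob (space \<mu> - {x. \<mu>.C x \<le> max 0 (1 - e)})"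
        using that by (intro \<mu>.finite_measure_mono) auto
      also have "\<dots> = 1 - max 0 (1 - e)"
        using that by (subst \<mu>.prob_compl) (auto simp: uniform)
      finally show ?thesis by simp
    qed
    then have "\<mu>.prob {x. \<mu>.C x \<ge> 1} \<le> 0"
      by (rule field_le_epsilon)
    then have "{x. \<mu>.C x \<ge> 1} \<in> null_sets \<mu>"
      by (intro null_setsI) (auto simp: \<mu>.emeasure_eq_measure measure_le_0_iff)
    then show ?thesis
      by (rule AE_I') auto
  qed
  ultimately have interior: "AE x in \<mu>. 0 < \<mu>.C x \<and> \<mu>.C x < 1" by eventually_elim simp
  have "distr \<mu> borel S = \<nu>"
  proof (intro cdf_unique ext)
    show "real_distribution (distr \<mu> borel S)" by simp
    show "real_distribution \<nu>" by fact
    fix z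
    have "cdf (distr \<mu> borel S) z = \<mu>.prob {x. S x \<le> z}"
      by (simp add: cdf_def measure_distr vimage_def)
    also have "\<dots> = \<mu>.prob {x. \<mu>.C x \<le> \<nu>.C z}"
      by (rule \<mu>.finite_measure_eq_AE) (use interior in \<open>auto simp: le\<close>)
    also have "\<dots> = \<nu>.C z"
      by (intro uniform \<nu>.cdf_nonneg \<nu>.cdf_bounded_prob)
    finally show "cdf (distr \<mu> borel S) z = \<nu>.C z" .
  qed
  then show ?thesis using S by blast
qed

text \<open>Transport on the line to the image of \<open>P\<close> under \<open>J\<close>, then
  decode: \<open>K\<close> undoes \<open>J\<close>, so it carries that image back to
  \<open>P\<close>.\<close>

lemma ex_transport_vec:
  fixes P :: "(real ^ 'd) measure"
  assumes "real_distribution \<mu>" and atomless: "\<And>x. measure \<mu> {x} = 0"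
    and P: "P \<in> space (prob_algebra borel)"
  shows "\<exists>S \<in> borel_measurable borel. distr \<mu> borel S = P"
proof -
  have setsP [measurable_cong]: "sets P = sets borel" and "prob_space P"
    using P by (auto simp: space_prob_algebra)
  interpret P: prob_space P by fact
  interpret \<mu>: real_distribution \<mu> by fact
  obtain J :: "real ^ 'd \<Rightarrow> real" and K where [measurable]: "J \<in> borel_measurable borel" "K \<in> borel_measurable borel"
    and KJ: "\<And>y. K (J y) = y"
    using ex_borel_embedding_real by blast
  have "real_distribution (distr P borel J)"
    by (rule P.real_distribution_distr) measurable
  then obtain S where S [measurable]: "S \<in> borel_measurable borel" and "distr \<mu> borel S = distr P borel J"
    using ex_transport_real[OF assms(1) atomless] by blast
  then have "distr (distr \<mu> borel S) borel K = distr (distr P borel J) borel K"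
    by simp
  also have "\<dots> = distr P borel (\<lambda>y. y)"
    by (simp add: distr_distr comp_def KJ)
  also have "\<dots> = P"
    by (rule distr_id2) (simp add: setsP)
  finally show ?thesis
    by (intro bexI[of _ "K \<circ> S"]) (simp_all add: distr_distr)
qed

section \<open>Approximation in one variable\<close>

text \<open>Hidden units are indexed by their own pair of slope and bias, so a sum of two networks
  lives on the union of the index sets. As in \<open>relu_nets\<close> the output has no bias;
  constants come from units of slope 0.\<close>

definition shallow_nets :: "(real \<Rightarrow> real) set" where
  "shallow_nets = {u. \<exists>B c. finite B \<and> u = (\<lambda>t. \<Sum>p\<in>B. c p * relu (fst p * t + snd p))}"

lemma shallow_nets_relu: "(\<lambda>t. relu (a * t + b)) \<in> shallow_nets"
  unfolding shallow_nets_def mem_Collect_eq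
  by (intro exI[of _ "{(a, b)}"] exI[of _ "\<lambda>_. 1"]) simp

lemma shallow_nets_zero: "(\<lambda>t. 0) \<in> shallow_nets"
  unfolding shallow_nets_def mem_Collect_eq
  by (intro exI[of _ "{}"]) simp

lemma shallow_nets_cmult:
  assumes "u \<in> shallow_nets"
  shows "(\<lambda>t. k * u t) \<in> shallow_nets"
proof -
  obtain B c where "finite B" and u: "u = (\<lambda>t. \<Sum>p\<in>B. c p * relu (fst p * t + snd p))"
    using assms by (auto simp: shallow_nets_def)
  then show ?thesis
    unfolding shallow_nets_def mem_Collect_eq
    by (intro exI[of _ B] exI[of _ "\<lambda>p. k * c p"]) (simp add: sum_distrib_left mult.assoc)
qed

lemma shallow_nets_extend:
  assumes "finite D" "B \<subseteq> D"
  shows "(\<Sum>p\<in>B. c p * relu (fst p * t + snd p)) =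
    (\<Sum>p\<in>D. (if p \<in> B then c p else 0) * relu (fst p * t + snd p))"
  using assms by (intro sum.mono_neutral_cong_left) auto

lemma shallow_nets_add:
  assumes "u \<in> shallow_nets" "v \<in> shallow_nets"
  shows "(\<lambda>t. u t + v t) \<in> shallow_nets"
proof -
  obtain B c B' c' where fin: "finite B" "finite B'"
    and u: "u = (\<lambda>t. \<Sum>p\<in>B. c p * relu (fst p * t + snd p))"
    and v: "v = (\<lambda>t. \<Sum>p\<in>B'. c' p * relu (fst p * t + snd p))"
    using assms by (auto simp: shallow_nets_def)
  have "u t + v t = (\<Sum>p\<in>B \<union> B'. ((if p \<in> B then c p else 0) + (if p \<in> B' then c' p else 0))
      * relu (fst p * t + snd p))" for t
    using fin unfolding u v
    by (simp only: shallow_nets_extend[of "B \<union> B'" B] shallow_nets_extend[of "B \<union> B'" B']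
        finite_UnI Un_upper1 Un_upper2 sum.distrib distrib_right)
  then show ?thesis
    unfolding shallow_nets_def mem_Collect_eq using fin
    by (intro exI[of _ "B \<union> B'"]
        exI[of _ "\<lambda>p. (if p \<in> B then c p else 0) + (if p \<in> B' then c' p else 0)"]) simp
qed

lemma borel_measurable_shallow_nets: "u \<in> shallow_nets \<Longrightarrow> u \<in> borel_measurable borel"
  by (auto simp: shallow_nets_def relu_def)

text \<open>Stands in for the triangle inequality without square roots; it drops the term
  \<open>(u t - v t)\<^sup>2\<close> from the parallelogram identity.\<close>

lemma integrable_square_add:
  fixes u v :: "'a \<Rightarrow> real"
  assumes [measurable]: "u \<in> borel_measurable M" "v \<in> borel_measurable M"
    and "integrable M (\<lambda>t. (u t)\<^sup>2)" "integrable M (\<lambda>t. (v t)\<^sup>2)"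
  shows "integrable M (\<lambda>t. (u t + v t)\<^sup>2)"
    and "(\<integral>t. (u t + v t)\<^sup>2 \<partial>M) \<le> 2 * (\<integral>t. (u t)\<^sup>2 \<partial>M) + 2 * (\<integral>t. (v t)\<^sup>2 \<partial>M)"
proof -
  have le: "(u t + v t)\<^sup>2 \<le> 2 * (u t)\<^sup>2 + 2 * (v t)\<^sup>2" for t
    using zero_le_power2[of "u t - v t"] by (simp add: power2_eq_square algebra_simps)
  have int: "integrable M (\<lambda>t. 2 * (u t)\<^sup>2 + 2 * (v t)\<^sup>2)"
    using assms by simp
  show *: "integrable M (\<lambda>t. (u t + v t)\<^sup>2)"
    by (rule Bochner_Integration.integrable_bound[OF int]) (auto intro: order_trans[OF le])
  show "(\<integral>t. (u t + v t)\<^sup>2 \<partial>M) \<le> 2 * (\<integral>t. (u t)\<^sup>2 \<partial>M) + 2 * (\<integral>t. (v t)\<^sup>2 \<partial>M)"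
    using integral_mono[OF * int le] assms by simp
qed

text \<open>Nets grow linearly, so they need not be square integrable themselves.\<close>

definition approximable :: "real measure \<Rightarrow> (real \<Rightarrow> real) \<Rightarrow> bool" where
  "approximable \<mu> u \<longleftrightarrow> u \<in> borel_measurable borel \<and>
     (\<forall>e>0. \<exists>v\<in>shallow_nets. integrable \<mu> (\<lambda>t. (v t)\<^sup>2) \<and>
       integrable \<mu> (\<lambda>t. (u t - v t)\<^sup>2) \<and> (\<integral>t. (u t - v t)\<^sup>2 \<partial>\<mu>) < e)"

context real_distribution
begin

lemma borel_measurable_M: "u \<in> borel_measurable borel \<Longrightarrow> u \<in> borel_measurable M"
  by (simp add: measurable_cong_sets[OF events_eq_borel refl])

lemma approximable_shallow_net:
  "u \<in> shallow_nets \<Longrightarrow> integrable M (\<lambda>t. (u t)\<^sup>2) \<Longrightarrow> approximable M u"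
  unfolding approximable_def by (auto intro!: borel_measurable_shallow_nets bexI[of _ u])

text \<open>The closure is closed: two errors below \<open>e / 4\<close> combine to less than
  \<open>e\<close> by \<open>integrable_square_add\<close>.\<close>

lemma approximable_closed:
  assumes u: "u \<in> borel_measurable borel"
    and "\<And>e. 0 < e \<Longrightarrow> \<exists>w. approximable M w \<and> integrable M (\<lambda>t. (u t - w t)\<^sup>2) \<and>
      (\<integral>t. (u t - w t)\<^sup>2 \<partial>M) < e"
  shows "approximable M u"
  unfolding approximable_def
proof (intro conjI u allI impI)
  fix e :: real assume "0 < e"
  obtain w where w: "approximable M w" "integrable M (\<lambda>t. (u t - w t)\<^sup>2)"
      "(\<integral>t. (u t - w t)\<^sup>2 \<partial>M) < e / 4"
    using assms(2)[of "e / 4"] \<open>0 < e\<close> by auto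
  obtain v where v: "v \<in> shallow_nets" "integrable M (\<lambda>t. (v t)\<^sup>2)"
      "integrable M (\<lambda>t. (w t - v t)\<^sup>2)" "(\<integral>t. (w t - v t)\<^sup>2 \<partial>M) < e / 4"
    using w(1) \<open>0 < e\<close> unfolding approximable_def by (meson zero_less_divide_iff zero_less_numeral)
  have "u \<in> borel_measurable M" "w \<in> borel_measurable M" "v \<in> borel_measurable M"
    using u w(1) borel_measurable_shallow_nets[OF v(1)]
    by (auto simp: approximable_def intro: borel_measurable_M)
  then have "integrable M (\<lambda>t. (u t - v t)\<^sup>2)" "(\<integral>t. (u t - v t)\<^sup>2 \<partial>M) < e"
    using integrable_square_add[of "\<lambda>t. u t - w t" M "\<lambda>t. w t - v t"] w v by simp_all
  with v show "\<exists>v\<in>shallow_nets. integrable M (\<lambda>t. (v t)\<^sup>2) \<and>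
      integrable M (\<lambda>t. (u t - v t)\<^sup>2) \<and> (\<integral>t. (u t - v t)\<^sup>2 \<partial>M) < e"
    by blast
qed

text \<open>Dominated convergence makes the squared errors tend to 0 in the mean, and
  \<open>approximable_closed\<close> does the rest.\<close>

lemma approximable_limit:
  assumes appr: "\<And>n. approximable M (s n)" and u: "u \<in> borel_measurable borel"
    and lim: "\<And>t. (\<lambda>n. s n t) \<longlonglongrightarrow> u t"
    and w: "integrable M w" and bound: "\<And>n t. (u t - s n t)\<^sup>2 \<le> w t"
  shows "approximable M u"
proof (rule approximable_closed[OF u])
  fix e :: real assume "0 < e"
  have [measurable]: "u \<in> borel_measurable M" "\<And>n. s n \<in> borel_measurable M"
    using u appr by (auto simp: approximable_def intro: borel_measurable_M)
  have int: "integrable M (\<lambda>t. (u t - s n t)\<^sup>2)" for n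
    by (rule Bochner_Integration.integrable_bound[OF w]) (auto intro: order_trans[OF bound abs_ge_self])
  have "(\<lambda>n. \<integral>t. (u t - s n t)\<^sup>2 \<partial>M) \<longlonglongrightarrow> (\<integral>t. 0 \<partial>M)"
  proof (rule integral_dominated_convergence[OF _ _ w])
    show "AE t in M. (\<lambda>n. (u t - s n t)\<^sup>2) \<longlonglongrightarrow> 0"
    proof (rule AE_I2)
      fix t
      have "(\<lambda>n. (u t - s n t)\<^sup>2) \<longlonglongrightarrow> (u t - u t)\<^sup>2"
        by (intro tendsto_intros lim)
      then show "(\<lambda>n. (u t - s n t)\<^sup>2) \<longlonglongrightarrow> 0" by simp
    qed
  qed (use bound in auto)
  then have "eventually (\<lambda>n. (\<integral>t. (u t - s n t)\<^sup>2 \<partial>M) < e) sequentially"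
    using \<open>0 < e\<close> by (auto dest: order_tendstoD)
  then show "\<exists>w. approximable M w \<and> integrable M (\<lambda>t. (u t - w t)\<^sup>2) \<and>
      (\<integral>t. (u t - w t)\<^sup>2 \<partial>M) < e"
    using appr int by (auto simp: eventually_sequentially)
qed

lemma approximable_zero: "approximable M (\<lambda>t. 0)"
  by (intro approximable_shallow_net shallow_nets_zero) simp

lemma approximable_add:
  assumes "approximable M u" "approximable M v"
  shows "approximable M (\<lambda>t. u t + v t)"
  unfolding approximable_def
proof (intro conjI allI impI)
  have u: "u \<in> borel_measurable borel" and v: "v \<in> borel_measurable borel"
    using assms by (auto simp: approximable_def)
  then show "(\<lambda>t. u t + v t) \<in> borel_measurable borel" by simp
  fix e :: real assume "0 < e"
  then have "0 < e / 4" by simp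
  obtain u' where u': "u' \<in> shallow_nets" "integrable M (\<lambda>t. (u' t)\<^sup>2)"
      "integrable M (\<lambda>t. (u t - u' t)\<^sup>2)" "(\<integral>t. (u t - u' t)\<^sup>2 \<partial>M) < e / 4"
    using assms(1) \<open>0 < e / 4\<close> unfolding approximable_def by blast
  obtain v' where v': "v' \<in> shallow_nets" "integrable M (\<lambda>t. (v' t)\<^sup>2)"
      "integrable M (\<lambda>t. (v t - v' t)\<^sup>2)" "(\<integral>t. (v t - v' t)\<^sup>2 \<partial>M) < e / 4"
    using assms(2) \<open>0 < e / 4\<close> unfolding approximable_def by blast
  have [measurable]: "u \<in> borel_measurable M" "v \<in> borel_measurable M"
      "u' \<in> borel_measurable M" "v' \<in> borel_measurable M"
    using u v u'(1) v'(1) by (auto intro: borel_measurable_M borel_measurable_shallow_nets)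
  have "(u t + v t - (u' t + v' t))\<^sup>2 = ((u t - u' t) + (v t - v' t))\<^sup>2" for t
    by (simp add: algebra_simps)
  then have "integrable M (\<lambda>t. (u t + v t - (u' t + v' t))\<^sup>2)"
      "(\<integral>t. (u t + v t - (u' t + v' t))\<^sup>2 \<partial>M) < e"
    using integrable_square_add[of "\<lambda>t. u t - u' t" M "\<lambda>t. v t - v' t"] u' v' by simp_all
  moreover have "integrable M (\<lambda>t. (u' t + v' t)\<^sup>2)"
    by (rule integrable_square_add) (use u' v' in simp_all)
  ultimately show "\<exists>w\<in>shallow_nets. integrable M (\<lambda>t. (w t)\<^sup>2) \<and>
      integrable M (\<lambda>t. (u t + v t - w t)\<^sup>2) \<and> (\<integral>t. (u t + v t - w t)\<^sup>2 \<partial>M) < e"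
    using u'(1) v'(1) by (intro bexI[of _ "\<lambda>t. u' t + v' t"] conjI shallow_nets_add)
qed

lemma approximable_cmult:
  assumes "approximable M u"
  shows "approximable M (\<lambda>t. k * u t)"
proof (cases "k = 0")
  case True
  then show ?thesis using approximable_zero by simp
next
  case False
  show ?thesis
    unfolding approximable_def
  proof (intro conjI allI impI)
    show "(\<lambda>t. k * u t) \<in> borel_measurable borel"
      using assms by (auto simp: approximable_def)
    fix e :: real assume "0 < e"
    then have "0 < e / k\<^sup>2" using False by simp
    then obtain v where v: "v \<in> shallow_nets" "integrable M (\<lambda>t. (v t)\<^sup>2)"
        "integrable M (\<lambda>t. (u t - v t)\<^sup>2)" "(\<integral>t. (u t - v t)\<^sup>2 \<partial>M) < e / k\<^sup>2"
      using assms unfolding approximable_def by blast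
    have "(k * u t - k * v t)\<^sup>2 = k\<^sup>2 * (u t - v t)\<^sup>2" for t
      by (simp add: right_diff_distrib[symmetric] power_mult_distrib)
    moreover have "k\<^sup>2 * (\<integral>t. (u t - v t)\<^sup>2 \<partial>M) < e"
      using v(4) False by (simp add: field_simps)
    ultimately have "integrable M (\<lambda>t. (k * u t - k * v t)\<^sup>2)"
        "(\<integral>t. (k * u t - k * v t)\<^sup>2 \<partial>M) < e"
      using v(3) by simp_all
    moreover have "integrable M (\<lambda>t. (k * v t)\<^sup>2)"
      using v(2) by (simp add: power_mult_distrib)
    ultimately show "\<exists>w\<in>shallow_nets. integrable M (\<lambda>t. (w t)\<^sup>2) \<and>
        integrable M (\<lambda>t. (k * u t - w t)\<^sup>2) \<and> (\<integral>t. (k * u t - w t)\<^sup>2 \<partial>M) < e"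
      using v(1) by (intro bexI[of _ "\<lambda>t. k * v t"] conjI shallow_nets_cmult)
  qed
qed

lemma approximable_sum:
  assumes "finite I" "\<And>i. i \<in> I \<Longrightarrow> approximable M (u i)"
  shows "approximable M (\<lambda>t. \<Sum>i\<in>I. u i t)"
  using assms by (induction I) (auto intro: approximable_zero approximable_add)

lemma approximable_one: "approximable M (\<lambda>t. 1)"
  using approximable_shallow_net[OF shallow_nets_relu[of 0 1]] by (simp add: relu_def)

lemma approximable_indicator_atMost: "approximable M (indicator {..a})"
proof -
  \<comment> \<open>A ramp made of two hinges: 1 up to \<open>a\<close>, falling with slope
    \<open>-n\<close>, and 0 from \<open>a + 1/n\<close> on (constantly 1 for \<open>n = 0\<close>).
    The linear growth of the hinges cancels, so it is square integrable for every \<mu>.\<close>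
  define s where "s n t = 1 + (-1) * relu (real n * t + (- real n * a)) + relu (real n * t + (- real n * a - 1))"
    for n t
  have s: "s n t = max 0 (1 - real n * max 0 (t - a))" for n t
  proof (cases "t \<le> a")
    case True
    then have "real n * t \<le> real n * a" by (simp add: mult_left_mono)
    then show ?thesis using True by (simp add: s_def relu_def max_def)
  next
    case False
    then have "real n * t \<ge> real n * a" by (simp add: mult_left_mono)
    then show ?thesis using False by (simp add: s_def relu_def max_def algebra_simps)
  qed
  have s_bounds: "0 \<le> s n t" "s n t \<le> 1" for n t
    by (simp_all add: s)
  show ?thesis
  proof (rule approximable_limit[where s = s and w = "\<lambda>_. 1"])
    show "approximable M (s n)" for n
    proof (rule approximable_shallow_net)
      \<comment> \<open>The constant 1 is the hinge of slope 0 and bias 1.\<close>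
      have "(\<lambda>t. relu (0 * t + 1) + (-1) * relu (real n * t + (- real n * a))
          + relu (real n * t + (- real n * a - 1))) \<in> shallow_nets"
        by (intro shallow_nets_add shallow_nets_cmult shallow_nets_relu)
      then show net: "s n \<in> shallow_nets"
        by (simp add: s_def[abs_def] relu_def)
      show "integrable M (\<lambda>t. (s n t)\<^sup>2)"
        using s_bounds[of n] borel_measurable_M[OF borel_measurable_shallow_nets[OF net]]
        by (intro integrable_const_bound[where B = 1]) (auto simp: power_le_one)
    qed
    show "indicator {..a} \<in> borel_measurable borel" by simp
    show "(\<lambda>n. s n t) \<longlonglongrightarrow> indicator {..a} t" for t
    proof (cases "t \<le> a")
      case True
      then show ?thesis by (simp add: s)
    next
      case False
      have "eventually (\<lambda>n. 1 / (t - a) \<le> real n) sequentially"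
        using filterlim_real_sequentially by (simp add: filterlim_at_top)
      then have "eventually (\<lambda>n. s n t = 0) sequentially"
        by (rule eventually_mono) (use False in \<open>simp add: s field_simps max_def\<close>)
      then show ?thesis
        using False by (simp add: tendsto_eventually)
    qed
    show "(indicator {..a} t - s n t)\<^sup>2 \<le> 1" for n t
      using s_bounds[of n t] by (auto simp: abs_square_le_1 indicator_def)
  qed simp
qed

text \<open>Dynkin's \<pi>-\<lambda> argument: half-lines are stable under intersection and generate
  the Borel sets; complements follow by linearity, countable disjoint unions by passing to the
  limit.\<close>

lemma approximable_indicator:
  assumes "A \<in> sets borel"
  shows "approximable M (indicator A)"
proof -
  have borel: "sigma_sets UNIV (range atMost) = sets (borel :: real measure)"
    by (subst borel_eq_atMost) simp
  have "Int_stable (range atMost :: real set set)"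
    by (auto simp: Int_stable_def intro: image_eqI[of _ _ "min _ _"])
  moreover have "range atMost \<subseteq> Pow (UNIV :: real set)"
    by simp
  moreover have "A \<in> sigma_sets UNIV (range atMost)"
    using assms borel by simp
  ultimately show ?thesis
  proof (induction rule: sigma_sets_induct_disjoint)
    case (basic A)
    then show ?case using approximable_indicator_atMost by auto
  next
    case empty
    then show ?case using approximable_zero by simp
  next
    case (compl A)
    have "approximable M (\<lambda>t. 1 + (-1) * indicator A t)"
      by (intro approximable_add approximable_cmult approximable_one compl)
    moreover have "(\<lambda>t. 1 + (-1) * indicator A t :: real) = indicator (UNIV - A)"
      by (auto simp: indicator_def)
    ultimately show ?case by simp
  next
    case (union A)
    \<comment> \<open>Disjointness makes the partial sums indicators again, so the squared error is
      dominated by 1.\<close>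
    have disj: "indicator (\<Union>i<n. A i) t = (\<Sum>i<n. indicator (A i) t :: real)" for n t
      using union.hyps(1) by (intro indicator_UN_disjoint) (auto simp: disjoint_family_on_def)
    show ?case
    proof (rule approximable_limit[where s = "\<lambda>n t. \<Sum>i<n. indicator (A i) t" and w = "\<lambda>_. 1"])
      show "approximable M (\<lambda>t. \<Sum>i<n. indicator (A i) t)" for n
        using union.IH by (intro approximable_sum) auto
      show "indicator (\<Union>i. A i) \<in> borel_measurable borel"
        using union.hyps(2) borel by auto
      show "(\<lambda>n. \<Sum>i<n. indicator (A i) t) \<longlonglongrightarrow> (indicator (\<Union>i. A i) t :: real)" for t
        unfolding disj[symmetric] by (rule LIMSEQ_indicator_UN)
      show "(indicator (\<Union>i. A i) t - (\<Sum>i<n. indicator (A i) t))\<^sup>2 \<le> (1 :: real)" for n t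
        unfolding disj[symmetric] by (auto simp: indicator_def)
    qed simp
  qed
qed

text \<open>Simple functions are combinations of indicators, and they can be chosen to converge to
  \<open>u\<close> under a bound proportional to \<bar>u\<bar>.\<close>

lemma approximable_square_integrable:
  assumes u: "u \<in> borel_measurable borel" and int: "integrable M (\<lambda>t. (u t)\<^sup>2)"
  shows "approximable M u"
proof -
  obtain s where s: "\<And>n. simple_function borel (s n)" "\<And>t. (\<lambda>n. s n t) \<longlonglongrightarrow> u t"
      "\<And>n t. \<bar>s n t\<bar> \<le> 2 * \<bar>u t\<bar>"
    using borel_measurable_implies_sequence_metric[OF u, of 0] by auto
  show ?thesis
  proof (rule approximable_limit[OF _ u s(2)])
    fix n
    have fin: "finite (range (s n))"
      using s(1)[of n] by (simp add: simple_function_def)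
    have "(\<Sum>y\<in>range (s n). y * indicator (s n -` {y}) t) = s n t" for t
    proof -
      have "(\<Sum>y\<in>range (s n). y * indicator (s n -` {y}) t)
          = (\<Sum>y\<in>range (s n). if y = s n t then y else 0)"
        by (intro sum.cong) (auto simp: indicator_def)
      also have "\<dots> = s n t"
        using fin by (subst sum.delta) auto
      finally show ?thesis .
    qed
    moreover have "approximable M (\<lambda>t. \<Sum>y\<in>range (s n). y * indicator (s n -` {y}) t)"
      using s(1)[of n] fin
      by (intro approximable_sum approximable_cmult approximable_indicator)
         (auto simp: simple_function_def)
    ultimately show "approximable M (s n)" by (simp only:)
  next
    \<comment> \<open>From \<bar>s\<bar> \<le> 2\<bar>u\<bar> the error is at most 3\<bar>u\<bar>; 9
      is the square of that 3.\<close>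
    show "integrable M (\<lambda>t. 9 * (u t)\<^sup>2)" using int by simp
    show "(u t - s n t)\<^sup>2 \<le> 9 * (u t)\<^sup>2" for n t
    proof -
      have "\<bar>u t - s n t\<bar> \<le> \<bar>3 * u t\<bar>"
        using s(3)[of n t] by (simp add: abs_mult)
      then have "(u t - s n t)\<^sup>2 \<le> (3 * u t)\<^sup>2"
        by (simp only: abs_le_square_iff)
      then show ?thesis by (simp add: power_mult_distrib)
    qed
  qed
qed

end

section \<open>Networks that depend on one coordinate\<close>

lemma relu_hidden_mono: "relu_hidden n i w g \<Longrightarrow> n \<le> m \<Longrightarrow> relu_hidden m i w g"
  by (induction rule: relu_hidden.induct) (auto intro: relu_hidden.step relu_hidden.first[unfolded One_nat_def])

lemma relu_nets_mono: "n \<le> m \<Longrightarrow> relu_nets l n \<subseteq> relu_nets l m"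
  unfolding relu_nets_def using relu_hidden_mono by blast

text \<open>The values of the first layer are nonnegative, so further layers can pass them on unchanged.\<close>

lemma relu_hidden_ridge:
  fixes k0 :: "'p::finite"
  assumes "1 \<le> l" "1 \<le> w"
  shows "relu_hidden w l w
    (\<lambda>x :: real ^ 'p. \<lambda>j. if j < w then relu (a j * x $ k0 + b j) else 0)"
  using assms(1)
proof (induction l rule: dec_induct)
  case base
  \<comment> \<open>Zero weights and bias beyond the width make those coordinates 0, so that the
    same function, not just its first \<open>w\<close> coordinates, reappears at every
    depth.\<close>
  have "(\<lambda>x j. relu ((\<Sum>k\<in>UNIV. (if j < w \<and> k = k0 then a j else 0) * x $ k) + (if j < w then b j else 0)))
      = (\<lambda>x :: real ^ 'p. \<lambda>j. if j < w then relu (a j * x $ k0 + b j) else 0)"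
    by (auto simp: fun_eq_iff relu_def if_distrib[of "\<lambda>u. u * _"] cong: if_cong)
  then show ?case
    using relu_hidden.first[of w w "\<lambda>j k. if j < w \<and> k = k0 then a j else 0" "\<lambda>j. if j < w then b j else 0"]
      assms(2) by simp
next
  case (step l)
  have "(\<lambda>x j. relu ((\<Sum>k<w. (if j = k then 1 else 0) *
        (if k < w then relu (a k * x $ k0 + b k) else 0)) + 0))
      = (\<lambda>x :: real ^ 'p. \<lambda>j. if j < w then relu (a j * x $ k0 + b j) else 0)"
    by (auto simp: fun_eq_iff relu_def if_distrib[of "\<lambda>u. u * _"] cong: if_cong)
  then show ?case
    using relu_hidden.step[OF step.IH, of w "\<lambda>j k. if j = k then 1 else 0" "\<lambda>_. 0"] assms(2)
    by simp
qed

text \<open>The units of all output components are pooled into one layer, and each row of the output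
  matrix puts coefficient 0 on units foreign to its component.\<close>

lemma shallow_nets_subset_relu_nets:
  fixes v :: "'d::finite \<Rightarrow> real \<Rightarrow> real" and k0 :: "'p::finite"
  assumes "\<And>i. v i \<in> shallow_nets" "1 \<le> l"
  shows "(\<lambda>x :: real ^ 'p. \<chi> i. v i (x $ k0)) \<in> (\<Union>n. relu_nets l n)"
proof -
  have "\<forall>i. \<exists>B c. finite B \<and> v i = (\<lambda>t. \<Sum>p\<in>B. c p * relu (fst p * t + snd p))"
    using assms(1) by (simp add: shallow_nets_def)
  from choice[OF this] obtain B where
    "\<forall>i. \<exists>c. finite (B i) \<and> v i = (\<lambda>t. \<Sum>p\<in>B i. c p * relu (fst p * t + snd p))" ..
  from choice[OF this] obtain c where fin: "\<And>i. finite (B i)"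
    and v: "\<And>i. v i = (\<lambda>t. \<Sum>p\<in>B i. c i p * relu (fst p * t + snd p))"
    by auto
  \<comment> \<open>The unit \<open>(0, 0)\<close> is identically 0; it ensures positive width when
    all the \<open>B i\<close> are empty.\<close>
  define D where "D = insert (0, 0) (\<Union>i. B i)"
  have "finite D" using fin by (simp add: D_def)
  then obtain h where h: "bij_betw h {..<card D} D"
    using ex_bij_betw_nat_finite[of D] by (auto simp: atLeast0LessThan)
  define C where "C i j = (if h j \<in> B i then c i (h j) else 0)" for i j
  define g where "g x j = (if j < card D then relu (fst (h j) * x $ k0 + snd (h j)) else 0)"
    for x :: "real ^ 'p" and j
  have "v i t = (\<Sum>j<card D. C i j * relu (fst (h j) * t + snd (h j)))" for i t
  proof -
    have "v i t = (\<Sum>p\<in>D. (if p \<in> B i then c i p else 0) * relu (fst p * t + snd p))"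
      unfolding v using \<open>finite D\<close> by (intro shallow_nets_extend) (auto simp: D_def)
    also have "\<dots> = (\<Sum>j<card D. C i j * relu (fst (h j) * t + snd (h j)))"
      unfolding C_def by (rule sum.reindex_bij_betw[OF h, symmetric])
    finally show ?thesis .
  qed
  then have "(\<lambda>x :: real ^ 'p. \<chi> i. v i (x $ k0)) = (\<lambda>x. \<chi> i. \<Sum>j<card D. C i j * g x j)"
    by (simp add: g_def)
  moreover have "1 \<le> card D"
    using \<open>finite D\<close> by (auto simp: D_def Suc_le_eq card_gt_0_iff)
  then have "relu_hidden (card D) l (card D) g"
    unfolding g_def[abs_def] by (rule relu_hidden_ridge[OF assms(2)])
  ultimately have "(\<lambda>x :: real ^ 'p. \<chi> i. v i (x $ k0)) \<in> relu_nets l (card D)"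
    unfolding relu_nets_def by blast
  then show ?thesis by blast
qed

text \<open>A sequence of sets converges when its lower and upper limits agree; this and the next
  lemma compute both for increasing sequences.\<close>

lemma liminf_eq_Union_mono:
  fixes A :: "nat \<Rightarrow> 'a set"
  assumes "\<And>n m. n \<le> m \<Longrightarrow> A n \<subseteq> A m"
  shows "liminf A = (\<Union>n. A n)"
proof -
  have "(\<Inter>m\<in>{n..}. A m) = A n" for n
    using assms by (auto simp: subset_iff)
  then show ?thesis
    by (simp add: liminf_SUP_INF)
qed

lemma limsup_eq_Union_mono:
  fixes A :: "nat \<Rightarrow> 'a set"
  assumes "\<And>n m. n \<le> m \<Longrightarrow> A n \<subseteq> A m"
  shows "limsup A = (\<Union>n. A n)"
proof -
  have "(\<Union>m\<in>{n..}. A m) = (\<Union>m. A m)" for n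
  proof
    show "(\<Union>m. A m) \<subseteq> (\<Union>m\<in>{n..}. A m)"
    proof
      fix x assume "x \<in> (\<Union>m. A m)"
      then obtain m where "x \<in> A m" by blast
      then have "x \<in> A (max n m)"
        using assms[of m "max n m"] by auto
      then show "x \<in> (\<Union>m\<in>{n..}. A m)"
        by (intro UN_I[of "max n m"]) auto
    qed
  qed auto
  then show ?thesis
    by (simp add: limsup_INF_SUP)
qed

section \<open>The transport map and its approximation by networks\<close>

lemma ex_approximable_transport:
  fixes Q :: "(real ^ 'p) measure" and P :: "(real ^ 'd) measure"
  assumes Q: "Q \<in> space (prob_algebra borel)"
    and dens: "Q = density lborel (\<lambda>x. ennreal (q x))" and q: "q \<in> borel_measurable borel"
    and P: "P \<in> finite_second_moment" and l: "1 \<le> l"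
  shows "\<exists>T \<in> L2_maps Q. distr Q borel T = P \<and>
    (\<forall>\<epsilon>>0. \<exists>g \<in> (\<Union>n. relu_nets l n) \<inter> L2_maps Q. L2_norm Q (\<lambda>x. T x - g x) < \<epsilon>)"
proof -
  have setsQ [measurable_cong]: "sets Q = sets borel" and "prob_space Q"
    using Q by (auto simp: space_prob_algebra)
  interpret Q: prob_space Q by fact
  have setsP [measurable_cong]: "sets P = sets borel"
    and P_prob: "P \<in> space (prob_algebra borel)" and P_int: "integrable P (\<lambda>y. (norm y)\<^sup>2)"
    using P by (auto simp: finite_second_moment_def space_prob_algebra)
  define k0 :: 'p where "k0 = undefined"
  define \<mu> where "\<mu> = distr Q borel (\<lambda>x. x $ k0)"
  interpret \<mu>: real_distribution \<mu>
    unfolding \<mu>_def by (rule Q.real_distribution_distr) measurable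
  \<comment> \<open>An atom of the marginal would be a hyperplane of positive
    \<open>Q\<close>-measure, but hyperplanes are Lebesgue null and \<open>Q\<close> has a
    density.\<close>
  have atomless: "measure \<mu> {t} = 0" for t
  proof -
    have "{x :: real ^ 'p. x $ k0 = t} \<in> null_sets lborel"
    proof -
      have "negligible {x :: real ^ 'p. axis k0 1 \<bullet> x = t}"
        by (rule negligible_hyperplane) (simp add: axis_eq_0_iff)
      then have "{x :: real ^ 'p. x $ k0 = t} \<in> null_sets lebesgue"
        by (simp add: negligible_iff_null_sets inner_axis' )
      then show ?thesis
        by (simp add: null_sets_completion_iff)
    qed
    then have "AE x in lborel. x $ k0 \<noteq> t"
      by (intro AE_I') auto
    then have "AE x in Q. x $ k0 \<noteq> t"
      unfolding dens using q by (subst AE_density) auto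
    then have "measure Q {x. x $ k0 = t} = 0"
      by (subst Q.prob_eq_0) (auto simp: sets_eq_imp_space_eq[OF setsQ])
    then show ?thesis
      by (simp add: \<mu>_def measure_distr vimage_def sets_eq_imp_space_eq[OF setsQ])
  qed
  obtain S where S [measurable]: "S \<in> borel_measurable borel" and "distr \<mu> borel S = P"
    using ex_transport_vec[OF \<mu>.real_distribution_axioms atomless P_prob] by blast
  then have P_eq: "P = distr \<mu> borel S" by simp
  have [measurable]: "(\<lambda>t. S t $ i) \<in> borel_measurable borel" for i
    by (rule measurable_compose[OF S]) measurable
  have transfer: "integrable Q (\<lambda>x. h (x $ k0)) \<longleftrightarrow> integrable \<mu> h"
      "(\<integral>x. h (x $ k0) \<partial>Q) = (\<integral>t. h t \<partial>\<mu>)"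
    if "h \<in> borel_measurable borel" for h :: "real \<Rightarrow> real"
    using that by (simp_all add: \<mu>_def integrable_distr_eq integral_distr)
  \<comment> \<open>Here the second moment of \<open>P\<close> enters: each squared coordinate is at
    most the squared norm.\<close>
  have S_int: "integrable \<mu> (\<lambda>t. (S t $ i)\<^sup>2)" for i
  proof -
    have "integrable P (\<lambda>y. (y $ i)\<^sup>2)"
      by (rule Bochner_Integration.integrable_bound[OF P_int])
        (auto simp: abs_le_square_iff[symmetric] component_le_norm_cart)
    then show ?thesis
      by (simp add: P_eq integrable_distr_eq \<mu>.borel_measurable_M)
  qed
  define T where "T x = S (x $ k0)" for x
  have T_meas: "T \<in> borel_measurable Q"
    unfolding T_def by measurable
  have "distr Q borel T = P"
    unfolding P_eq \<mu>_def T_def by (subst distr_distr) (auto simp: comp_def)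
  moreover have "T \<in> L2_maps Q"
    using T_meas S_int transfer(1)[of "\<lambda>t. (S t $ i)\<^sup>2" for i]
    by (simp add: L2_maps_def T_def[abs_def])
  moreover have "\<exists>g \<in> (\<Union>n. relu_nets l n) \<inter> L2_maps Q. L2_norm Q (\<lambda>x. T x - g x) < \<epsilon>"
    if "0 < \<epsilon>" for \<epsilon>
  proof -
    \<comment> \<open>The squared norm adds up one error per output coordinate, so each gets an
      equal share of the square of \<epsilon>.\<close>
    define e where "e = \<epsilon>\<^sup>2 / real CARD('d)"
    have "0 < e" using that by (simp add: e_def)
    have "\<forall>i. \<exists>v. v \<in> shallow_nets \<and> integrable \<mu> (\<lambda>t. (v t)\<^sup>2) \<and>
        (\<integral>t. (S t $ i - v t)\<^sup>2 \<partial>\<mu>) < e"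
    proof
      fix i
      have "approximable \<mu> (\<lambda>t. S t $ i)"
        using S_int by (intro \<mu>.approximable_square_integrable) auto
      then show "\<exists>v. v \<in> shallow_nets \<and> integrable \<mu> (\<lambda>t. (v t)\<^sup>2) \<and>
          (\<integral>t. (S t $ i - v t)\<^sup>2 \<partial>\<mu>) < e"
        using \<open>0 < e\<close> unfolding approximable_def by blast
    qed
    from choice[OF this] obtain v where v: "\<And>i. v i \<in> shallow_nets"
        "\<And>i. integrable \<mu> (\<lambda>t. (v i t)\<^sup>2)" "\<And>i. (\<integral>t. (S t $ i - v i t)\<^sup>2 \<partial>\<mu>) < e"
      by blast
    have [measurable]: "v i \<in> borel_measurable borel" for i
      by (rule borel_measurable_shallow_nets) (rule v)
    define g :: "real ^ 'p \<Rightarrow> real ^ 'd" where "g x = (\<chi> i. v i (x $ k0))" for x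
    have "g \<in> (\<Union>n. relu_nets l n)"
      unfolding g_def[abs_def] by (rule shallow_nets_subset_relu_nets[OF v(1) l])
    moreover have "(\<lambda>x. g x $ i) \<in> borel_measurable Q" for i
      unfolding g_def vec_lambda_beta by measurable
    then have "g \<in> borel_measurable Q"
      by (subst borel_measurable_euclidean_space) (auto simp: Basis_vec_def inner_axis)
    then have "g \<in> L2_maps Q"
      using v(2) transfer(1)[of "\<lambda>t. (v i t)\<^sup>2" for i] by (simp add: L2_maps_def g_def)
    moreover have "L2_norm Q (\<lambda>x. T x - g x) < \<epsilon>"
    proof -
      have "(\<Sum>i\<in>UNIV. \<integral>x. ((T x - g x) $ i)\<^sup>2 \<partial>Q) = (\<Sum>i\<in>UNIV. \<integral>t. (S t $ i - v i t)\<^sup>2 \<partial>\<mu>)"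
        using transfer(2)[of "\<lambda>t. (S t $ i - v i t)\<^sup>2" for i] by (simp add: T_def g_def)
      also have "\<dots> < (\<Sum>i\<in>(UNIV :: 'd set). e)"
        using v(3) by (intro sum_strict_mono) auto
      also have "\<dots> = \<epsilon>\<^sup>2"
        by (simp add: e_def)
      finally show ?thesis
        unfolding L2_norm_def using that by (intro real_less_lsqrt) auto
    qed
    ultimately show ?thesis by blast
  qed
  ultimately show ?thesis by blast
qed

theorem proposition3:
  fixes Q :: "(real ^ 'p) measure" and P :: "(real ^ 'd) measure"
    and q :: "real ^ 'p \<Rightarrow> real" and f :: "real ^ 'd \<Rightarrow> real"
    and l :: nat and \<T> :: "nat \<Rightarrow> (real ^ 'p \<Rightarrow> real ^ 'd) set"
  assumes "Q \<in> space (prob_algebra borel)"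
    and "\<And>x. measure Q {x} = 0"
    and "Q = density lborel (\<lambda>x. ennreal (q x))"
    and "\<And>x. 0 < q x" and "continuous_on UNIV q" and "bounded (range q)"
    and "P \<in> finite_second_moment"
    and "f \<in> borel_measurable borel"
    and "P = density lborel (\<lambda>x. ennreal (f x))"
    and "\<And>x. 0 < f x"
    and "l = nat \<lceil>log 2 (real CARD('p) + 1)\<rceil>"
    and "\<And>n. \<T> n = relu_nets l n"
  shows "\<exists>\<TT>. \<TT> \<subseteq> L2_maps Q \<and> (\<exists>T\<in>\<TT>. distr Q borel T = P) \<and>
    (\<forall>n. \<T> n \<inter> L2_maps Q \<subseteq> \<TT>) \<and> (\<forall>n m. n \<le> m \<longrightarrow> \<T> n \<subseteq> \<T> m) \<and>
    liminf \<T> = (\<Union>n. \<T> n) \<and> limsup \<T> = (\<Union>n. \<T> n) \<and>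
    L2_dense_in Q ((\<Union>n. \<T> n) \<inter> L2_maps Q) \<TT>"
proof -
  let ?N = "(\<Union>n. \<T> n) \<inter> L2_maps Q"
  \<comment> \<open>Density is built into this closure, so the real content is that it contains a
    transport map.\<close>
  define \<TT> where "\<TT> = {T \<in> L2_maps Q. \<forall>\<epsilon>>0. \<exists>g\<in>?N. L2_norm Q (\<lambda>x. T x - g x) < \<epsilon>}"
  \<comment> \<open>Ensures at least one hidden layer, as the one-coordinate networks
    require.\<close>
  have "0 < log 2 (real CARD('p) + 1)"
    using zero_less_card_finite[where 'a = 'p] by (subst zero_less_log_cancel_iff) auto
  then have "1 \<le> l"
    by (simp add: assms(11) Suc_le_eq)
  have mono: "\<T> n \<subseteq> \<T> m" if "n \<le> m" for n m
    using relu_nets_mono[OF that] assms(12) by simp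
  have liminf: "liminf \<T> = (\<Union>n. \<T> n)"
    by (rule liminf_eq_Union_mono) (rule mono)
  have limsup: "limsup \<T> = (\<Union>n. \<T> n)"
    by (rule limsup_eq_Union_mono) (rule mono)
  have "\<exists>T\<in>\<TT>. distr Q borel T = P"
  proof -
    obtain T where "T \<in> L2_maps Q" "distr Q borel T = P"
        "\<And>\<epsilon>. 0 < \<epsilon> \<Longrightarrow> \<exists>g \<in> (\<Union>n. relu_nets l n) \<inter> L2_maps Q. L2_norm Q (\<lambda>x. T x - g x) < \<epsilon>"
      using ex_approximable_transport[OF assms(1,3) _ assms(7) \<open>1 \<le> l\<close>]
        borel_measurable_continuous_onI[OF assms(5)] by blast
    then show ?thesis
      by (auto simp: \<TT>_def assms(12))
  qed
  moreover have "?N \<subseteq> \<TT>"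
  proof
    fix g assume "g \<in> ?N"
    then show "g \<in> \<TT>"
      unfolding \<TT>_def by (auto simp: L2_norm_def intro!: bexI[of _ g])
  qed
  moreover have "\<TT> \<subseteq> L2_maps Q"
    by (auto simp: \<TT>_def)
  moreover have "L2_dense_in Q ?N \<TT>"
    using \<open>?N \<subseteq> \<TT>\<close> by (simp add: L2_dense_in_def \<TT>_def)
  ultimately show ?thesis
    using mono liminf limsup by (intro exI[of _ \<TT>]) (auto simp: subset_iff)
qed

end
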